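(* The abstract commensurator $\operatorname{Comm}((\mathbb{Z}/2\mathbb{Z})\wr\mathbb{Z})$ of the lamplighter group contains every finite group as a subgroup; that is, every finite group is isomorphic to a subgroup of it.
   Context: The lamplighter group is the restricted wreath product $(\mathbb{Z}/2\mathbb{Z})\wr\mathbb{Z}=\bigl(\bigoplus_{\mathbb{Z}}\mathbb{Z}/2\mathbb{Z}\bigr)\rtimes\mathbb{Z}$, with $\mathbb{Z}$ acting by translation of indices. A partial automorphism of a group $\Gamma$ is an isomorphism between two finite-index subgroups of $\Gamma$; two are equivalent if they agree on some finite-index subgroup. The abstract commensurator $\operatorname{Comm}(\Gamma)$ is the group of equivalence classes of partial automorphisms under composition. *)

theory Defs
  imports "HOL-Algebra.Algebra"
begin

section \<open>The lamplighter group\<close>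

definition semidirect_product ::
    "('a, 'c) monoid_scheme \<Rightarrow> ('b, 'd) monoid_scheme \<Rightarrow> ('b \<Rightarrow> 'a \<Rightarrow> 'a) \<Rightarrow> ('a \<times> 'b) monoid"
  where "semidirect_product N B act =
    \<lparr>carrier = carrier N \<times> carrier B,
     monoid.mult = (\<lambda>(a, h) (b, k). (a \<otimes>\<^bsub>N\<^esub> act h b, h \<otimes>\<^bsub>B\<^esub> k)),
     one = (\<one>\<^bsub>N\<^esub>, \<one>\<^bsub>B\<^esub>)\<rparr>"

definition restricted_wreath_product ::
    "('a, 'c) monoid_scheme \<Rightarrow> ('b, 'd) monoid_scheme \<Rightarrow> (('b \<Rightarrow> 'a) \<times> 'b) monoid"
  where "restricted_wreath_product A B =
    semidirect_product (sum_group (carrier B) (\<lambda>_. A)) B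
      (\<lambda>h f. \<lambda>x\<in>carrier B. f (inv\<^bsub>B\<^esub> h \<otimes>\<^bsub>B\<^esub> x))"

definition lamplighter_group :: "((int \<Rightarrow> int) \<times> int) monoid"
  where "lamplighter_group = restricted_wreath_product (integer_mod_group 2) integer_group"


section \<open>The abstract commensurator\<close>

definition finite_index_subgroup :: "('a, 'b) monoid_scheme \<Rightarrow> 'a set \<Rightarrow> bool"
  where "finite_index_subgroup G H \<longleftrightarrow> subgroup H G \<and> finite (rcosets\<^bsub>G\<^esub> H)"

text \<open>A partial automorphism is encoded by its domain \<open>H\<close> and a map that is \<open>undefined\<close> off \<open>H\<close>;
  its range is the image of \<open>H\<close>.\<close>

definition partial_automorphisms :: "('a, 'b) monoid_scheme \<Rightarrow> ('a set \<times> ('a \<Rightarrow> 'a)) set"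
  where "partial_automorphisms G =
    {(H, f). finite_index_subgroup G H \<and> f \<in> extensional H \<and>
       (\<exists>K. finite_index_subgroup G K \<and> f \<in> iso (G\<lparr>carrier := H\<rparr>) (G\<lparr>carrier := K\<rparr>))}"

definition commensurator_rel ::
    "('a, 'b) monoid_scheme \<Rightarrow> (('a set \<times> ('a \<Rightarrow> 'a)) \<times> ('a set \<times> ('a \<Rightarrow> 'a))) set"
  where "commensurator_rel G =
    {((H, f), (H', f')).
       (H, f) \<in> partial_automorphisms G \<and> (H', f') \<in> partial_automorphisms G \<and>
       (\<exists>L. finite_index_subgroup G L \<and> L \<subseteq> H \<inter> H' \<and> (\<forall>x\<in>L. f x = f' x))}"

text \<open>The composite (second argument applied first) lives on the largest subset where it makes sense.\<close>

fun partial_comp :: "'a set \<times> ('a \<Rightarrow> 'a) \<Rightarrow> 'a set \<times> ('a \<Rightarrow> 'a) \<Rightarrow> 'a set \<times> ('a \<Rightarrow> 'a)"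
  where "partial_comp (H, f) (H', f') =
    ({x \<in> H'. f' x \<in> H}, \<lambda>x\<in>{x \<in> H'. f' x \<in> H}. f (f' x))"

definition Comm :: "('a, 'b) monoid_scheme \<Rightarrow> ('a set \<times> ('a \<Rightarrow> 'a)) set monoid"
  where "Comm G =
    \<lparr>carrier = partial_automorphisms G // commensurator_rel G,
     monoid.mult = (\<lambda>U V. \<Union>p\<in>U. \<Union>q\<in>V. commensurator_rel G `` {partial_comp p q}),
     one = commensurator_rel G `` {(carrier G, \<lambda>x\<in>carrier G. x)}\<rparr>"


section \<open>Both constructions yield groups\<close>

lemma group_semidirect_product:
  assumes "group N" "group B"
    and hom: "\<And>h. h \<in> carrier B \<Longrightarrow> act h \<in> hom N N"
    and one: "\<And>a. a \<in> carrier N \<Longrightarrow> act \<one>\<^bsub>B\<^esub> a = a"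
    and mult: "\<And>h k a. \<lbrakk>h \<in> carrier B; k \<in> carrier B; a \<in> carrier N\<rbrakk>
                 \<Longrightarrow> act (h \<otimes>\<^bsub>B\<^esub> k) a = act h (act k a)"
  shows "group (semidirect_product N B act)"
proof -
  interpret N: group N by fact
  interpret B: group B by fact
  have cl: "act h a \<in> carrier N" if "h \<in> carrier B" "a \<in> carrier N" for h a
    using hom[OF that(1)] that(2) by (auto simp: hom_def)
  have dist: "act h (a \<otimes>\<^bsub>N\<^esub> b) = act h a \<otimes>\<^bsub>N\<^esub> act h b"
    if "h \<in> carrier B" "a \<in> carrier N" "b \<in> carrier N" for h a b
    using hom[OF that(1)] that(2,3) by (auto simp: hom_def)
  have act_one: "act h \<one>\<^bsub>N\<^esub> = \<one>\<^bsub>N\<^esub>" if "h \<in> carrier B" for h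
    using hom_one[OF hom[OF that]] assms(1) by blast
  show ?thesis
  proof (rule groupI)
    fix x assume x: "x \<in> carrier (semidirect_product N B act)"
    then obtain a h where ah: "x = (a, h)" "a \<in> carrier N" "h \<in> carrier B"
      by (auto simp: semidirect_product_def)
    let ?y = "(act (inv\<^bsub>B\<^esub> h) (inv\<^bsub>N\<^esub> a), inv\<^bsub>B\<^esub> h)"
    have "?y \<otimes>\<^bsub>semidirect_product N B act\<^esub> x = \<one>\<^bsub>semidirect_product N B act\<^esub>"
      using ah by (simp add: semidirect_product_def dist[symmetric] act_one)
    moreover have "?y \<in> carrier (semidirect_product N B act)"
      using ah cl by (simp add: semidirect_product_def)
    ultimately show "\<exists>y\<in>carrier (semidirect_product N B act).
        y \<otimes>\<^bsub>semidirect_product N B act\<^esub> x = \<one>\<^bsub>semidirect_product N B act\<^esub>" by blast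
  qed (auto simp: semidirect_product_def cl one dist mult N.m_assoc B.m_assoc)
qed

lemma group_restricted_wreath_product:
  assumes "group A" "group B"
  shows "group (restricted_wreath_product A B)"
proof -
  interpret A: group A by fact
  interpret B: group B by fact
  let ?N = "sum_group (carrier B) (\<lambda>_. A)"
  let ?act = "\<lambda>h f. \<lambda>x\<in>carrier B. f (inv\<^bsub>B\<^esub> h \<otimes>\<^bsub>B\<^esub> x)"
  have carr: "carrier ?N =
      {x \<in> \<Pi>\<^sub>E i\<in>carrier B. carrier A. finite {i \<in> carrier B. x i \<noteq> \<one>\<^bsub>A\<^esub>}}"
    by (simp add: carrier_sum_group assms)
  have cl: "?act h f \<in> carrier ?N" if h: "h \<in> carrier B" and f: "f \<in> carrier ?N" for h f
  proof -
    have "{i \<in> carrier B. ?act h f i \<noteq> \<one>\<^bsub>A\<^esub>} \<subseteq>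
        (\<lambda>i. h \<otimes>\<^bsub>B\<^esub> i) ` {i \<in> carrier B. f i \<noteq> \<one>\<^bsub>A\<^esub>}"
    proof
      fix i assume i: "i \<in> {i \<in> carrier B. ?act h f i \<noteq> \<one>\<^bsub>A\<^esub>}"
      with h have "i = h \<otimes>\<^bsub>B\<^esub> (inv\<^bsub>B\<^esub> h \<otimes>\<^bsub>B\<^esub> i)" by (simp add: B.m_assoc[symmetric])
      with h i show "i \<in> (\<lambda>i. h \<otimes>\<^bsub>B\<^esub> i) ` {i \<in> carrier B. f i \<noteq> \<one>\<^bsub>A\<^esub>}" by force
    qed
    moreover have "finite {i \<in> carrier B. f i \<noteq> \<one>\<^bsub>A\<^esub>}" using f carr by auto
    ultimately have "finite {i \<in> carrier B. ?act h f i \<noteq> \<one>\<^bsub>A\<^esub>}"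
      using finite_surj by blast
    then show ?thesis using f h unfolding carr by auto
  qed
  show ?thesis unfolding restricted_wreath_product_def
  proof (rule group_semidirect_product)
    show "group ?N" by (simp add: assms)
    show "group B" by fact
    fix h assume h: "h \<in> carrier B"
    show "?act h \<in> hom ?N ?N" using cl[OF h] h by (auto simp: hom_def fun_eq_iff)
  next
    fix f assume "f \<in> carrier ?N"
    then show "?act \<one>\<^bsub>B\<^esub> f = f" unfolding carr by (auto simp: fun_eq_iff PiE_def extensional_def)
  next
    fix h k f assume "h \<in> carrier B" "k \<in> carrier B" "f \<in> carrier ?N"
    then show "?act (h \<otimes>\<^bsub>B\<^esub> k) f = ?act h (?act k f)"
      by (auto simp: fun_eq_iff B.inv_mult_group B.m_assoc)
  qed
qed

lemma group_lamplighter_group: "group lamplighter_group"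
  by (simp add: lamplighter_group_def group_restricted_wreath_product)

context group
begin

lemma finite_index_subgroupI:
  assumes M: "subgroup M G" and fin: "finite (c ` carrier G)"
    and c: "\<And>x y. \<lbrakk>x \<in> carrier G; y \<in> carrier G; c x = c y\<rbrakk> \<Longrightarrow> x \<otimes> inv y \<in> M"
  shows "finite_index_subgroup G M"
proof -
  let ?r = "\<lambda>v. SOME x. x \<in> carrier G \<and> c x = v"
  have "M #> x = M #> ?r (c x)" if x: "x \<in> carrier G" for x
  proof -
    have r: "?r (c x) \<in> carrier G \<and> c (?r (c x)) = c x"
      by (rule someI[where x = x]) (use x in auto)
    then have "?r (c x) \<otimes> inv x \<in> M" using c x by blast
    then have "?r (c x) \<in> M #> x"
      using subgroup.rcos_module_rev[OF M is_group x] r by blast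
    then show ?thesis using repr_independence x M by blast
  qed
  then have "rcosets M \<subseteq> (\<lambda>v. M #> ?r v) ` (c ` carrier G)"
    unfolding RCOSETS_def by blast
  then show ?thesis
    using M fin finite_subset unfolding finite_index_subgroup_def by blast
qed

lemma finite_index_subgroupD:
  assumes "finite_index_subgroup G M"
  shows "subgroup M G" "finite ((\<lambda>x. M #> x) ` carrier G)"
    "\<And>x y. \<lbrakk>x \<in> carrier G; y \<in> carrier G; M #> x = M #> y\<rbrakk> \<Longrightarrow> x \<otimes> inv y \<in> M"
proof -
  show M: "subgroup M G" using assms by (simp add: finite_index_subgroup_def)
  have "rcosets M = (\<lambda>x. M #> x) ` carrier G" unfolding RCOSETS_def by blast
  then show "finite ((\<lambda>x. M #> x) ` carrier G)"
    using assms by (simp add: finite_index_subgroup_def)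
  show "x \<otimes> inv y \<in> M" if "x \<in> carrier G" "y \<in> carrier G" "M #> x = M #> y" for x y
    using subgroup.rcos_module_imp[OF M is_group that(2)] rcos_self[OF that(1) M] that(3) by blast
qed

lemma finite_index_subgroup_carrier: "finite_index_subgroup G (carrier G)"
  by (rule finite_index_subgroupI[where c = "\<lambda>_. ()"]) (auto simp: subgroup_self)

lemma finite_index_subgroup_Int:
  assumes M: "finite_index_subgroup G M" and N: "finite_index_subgroup G N"
  shows "finite_index_subgroup G (M \<inter> N)"
proof (rule finite_index_subgroupI[where c = "\<lambda>x. (M #> x, N #> x)"])
  show "subgroup (M \<inter> N) G"
    using finite_index_subgroupD(1) M N subgroups_Inter_pair by blast
  have "(\<lambda>x. (M #> x, N #> x)) ` carrier G
      \<subseteq> (\<lambda>x. M #> x) ` carrier G \<times> (\<lambda>x. N #> x) ` carrier G" by auto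
  then show "finite ((\<lambda>x. (M #> x, N #> x)) ` carrier G)"
    by (rule finite_subset) (simp add: finite_index_subgroupD(2) M N)
qed (use finite_index_subgroupD(3)[OF M] finite_index_subgroupD(3)[OF N] in auto)

lemma finite_index_subgroup_vimage:
  assumes H: "finite_index_subgroup G H" and L: "finite_index_subgroup G L"
    and f: "f \<in> hom (G\<lparr>carrier := H\<rparr>) G"
  shows "finite_index_subgroup G {x \<in> H. f x \<in> L}"
proof -
  note sH = finite_index_subgroupD(1)[OF H] and sL = finite_index_subgroupD(1)[OF L]
  interpret H: subgroup H G by (rule sH)
  interpret L: subgroup L G by (rule sL)
  interpret GH: group "G\<lparr>carrier := H\<rparr>" using sH subgroup_imp_group by blast
  have fcl: "f x \<in> carrier G" if "x \<in> H" for x using f that by (auto simp: hom_def)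
  have fm: "f (x \<otimes> y) = f x \<otimes> f y" if "x \<in> H" "y \<in> H" for x y
    using f that by (auto simp: hom_def)
  have f1: "f \<one> = \<one>"
    using hom_one[OF f GH.is_group is_group] by simp
  have finv: "f (inv x) = inv (f x)" if "x \<in> H" for x
  proof (rule inv_equality[symmetric])
    show "f (inv x) \<otimes> f x = \<one>" using fm[of "inv x" x] that f1 by simp
  qed (use fcl that in auto)
  define r where "r x = (SOME y. y \<in> carrier G \<and> H #> y = H #> x)" for x
  have r: "r x \<in> carrier G" "H #> r x = H #> x" if "x \<in> carrier G" for x
    using someI[of "\<lambda>y. y \<in> carrier G \<and> H #> y = H #> x" x] that unfolding r_def by auto
  have rH: "x \<otimes> inv (r x) \<in> H" if "x \<in> carrier G" for x
    using finite_index_subgroupD(3)[OF H] r that by metis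
  show ?thesis
  proof (rule finite_index_subgroupI[where c = "\<lambda>x. (H #> x, L #> f (x \<otimes> inv (r x)))"])
    show "subgroup {x \<in> H. f x \<in> L} G"
      by (rule subgroupI) (auto simp: f1 fm finv intro: exI[of _ \<one>])
    have "(\<lambda>x. (H #> x, L #> f (x \<otimes> inv (r x)))) ` carrier G
        \<subseteq> (\<lambda>x. H #> x) ` carrier G \<times> (\<lambda>x. L #> x) ` carrier G"
      using rH fcl by auto
    then show "finite ((\<lambda>x. (H #> x, L #> f (x \<otimes> inv (r x)))) ` carrier G)"
      by (rule finite_subset) (simp add: finite_index_subgroupD(2) H L)
    fix x y assume x: "x \<in> carrier G" and y: "y \<in> carrier G"
      and eq: "(H #> x, L #> f (x \<otimes> inv (r x))) = (H #> y, L #> f (y \<otimes> inv (r y)))"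
    have rr: "r x = r y" using eq by (simp add: r_def)
    have "f (x \<otimes> inv (r x)) \<otimes> inv (f (y \<otimes> inv (r y))) \<in> L"
      using finite_index_subgroupD(3)[OF L] eq fcl rH x y by simp
    moreover have "f (x \<otimes> inv (r x)) \<otimes> inv (f (y \<otimes> inv (r y)))
        = f ((x \<otimes> inv (r x)) \<otimes> inv (y \<otimes> inv (r y)))"
      using rH x y by (simp add: fm finv)
    moreover have "(x \<otimes> inv (r x)) \<otimes> inv (y \<otimes> inv (r y)) = x \<otimes> inv y"
    proof -
      have "(x \<otimes> inv (r x)) \<otimes> inv (y \<otimes> inv (r y)) = x \<otimes> (inv (r y) \<otimes> r y) \<otimes> inv y"
        using x y r(1)[OF y] by (simp only: rr inv_mult_group m_assoc inv_closed m_closed inv_inv)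
      then show ?thesis using x y r(1)[OF y] by simp
    qed
    moreover have "x \<otimes> inv y \<in> H" using finite_index_subgroupD(3)[OF H] eq x y by simp
    ultimately show "x \<otimes> inv y \<in> {x \<in> H. f x \<in> L}" by simp
  qed
qed

lemma partial_automorphisms_iff:
  "(H, f) \<in> partial_automorphisms G \<longleftrightarrow>
     finite_index_subgroup G H \<and> finite_index_subgroup G (f ` H) \<and> f \<in> extensional H \<and>
     inj_on f H \<and> (\<forall>x\<in>H. \<forall>y\<in>H. f (x \<otimes> y) = f x \<otimes> f y)"
  by (auto simp: partial_automorphisms_def iso_def hom_def bij_betw_def)

lemma partial_automorphisms_hom:
  assumes "(H, f) \<in> partial_automorphisms G"
  shows "f \<in> hom (G\<lparr>carrier := H\<rparr>) G"
proof -
  have "subgroup (f ` H) G"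
    using assms finite_index_subgroupD(1) unfolding partial_automorphisms_iff by blast
  then have "f ` H \<subseteq> carrier G" by (rule subgroup.subset)
  then show ?thesis using assms by (auto simp: partial_automorphisms_iff hom_def)
qed

lemma partial_automorphisms_inv:
  assumes "(H, f) \<in> partial_automorphisms G"
  shows "(f ` H, \<lambda>x\<in>f ` H. inv_into H f x) \<in> partial_automorphisms G"
proof -
  note a = assms[unfolded partial_automorphisms_iff]
  interpret H: subgroup H G using a finite_index_subgroupD(1) by blast
  interpret fH: subgroup "f ` H" G using a finite_index_subgroupD(1) by blast
  have i: "inv_into H f (f x) = x" if "x \<in> H" for x using a that by simp
  have e: "f x \<otimes> f y = f (x \<otimes> y)" if "x \<in> H" "y \<in> H" for x y using a that by simp
  have "(\<lambda>x\<in>f ` H. inv_into H f x) ` (f ` H) = H"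
    using i by (force simp: image_iff)
  moreover have "inj_on (\<lambda>x\<in>f ` H. inv_into H f x) (f ` H)"
    by (auto simp: inj_on_def i)
  ultimately show ?thesis
    using a unfolding partial_automorphisms_iff by (auto simp: i e)
qed

lemma partial_comp_closed:
  assumes p: "p \<in> partial_automorphisms G" and q: "q \<in> partial_automorphisms G"
  shows "partial_comp p q \<in> partial_automorphisms G"
proof -
  obtain H f where pe: "p = (H, f)" by force
  obtain K g where qe: "q = (K, g)" by force
  note a = p[unfolded pe partial_automorphisms_iff] and b = q[unfolded qe partial_automorphisms_iff]
  let ?D = "{x \<in> K. g x \<in> H}"
  let ?f' = "\<lambda>x\<in>f ` H. inv_into H f x"
  interpret H: subgroup H G using a finite_index_subgroupD(1) by blast
  interpret K: subgroup K G using b finite_index_subgroupD(1) by blast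
  have D: "finite_index_subgroup G ?D"
    using finite_index_subgroup_vimage a b partial_automorphisms_hom q qe by blast
  have "(\<lambda>x\<in>?D. f (g x)) ` ?D = {x \<in> f ` H. ?f' x \<in> g ` K}"
  proof (intro Set.set_eqI iffI)
    fix y assume "y \<in> {x \<in> f ` H. ?f' x \<in> g ` K}"
    then obtain h where h: "h \<in> H" "y = f h" "?f' y \<in> g ` K" by blast
    then have "h \<in> g ` K" using a by simp
    then show "y \<in> (\<lambda>x\<in>?D. f (g x)) ` ?D" using h by auto
  next
    fix y assume "y \<in> (\<lambda>x\<in>?D. f (g x)) ` ?D"
    then obtain x where x: "x \<in> K" "g x \<in> H" "y = f (g x)" by auto
    then have "?f' y = g x" using a by simp
    then show "y \<in> {x \<in> f ` H. ?f' x \<in> g ` K}" using x by auto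
  qed
  moreover have "finite_index_subgroup G {x \<in> f ` H. ?f' x \<in> g ` K}"
    using finite_index_subgroup_vimage[OF _ _ partial_automorphisms_hom]
      partial_automorphisms_inv p pe a b by blast
  ultimately have "finite_index_subgroup G ((\<lambda>x\<in>?D. f (g x)) ` ?D)" by simp
  moreover have "inj_on (\<lambda>x\<in>?D. f (g x)) ?D"
    using a b by (auto simp: inj_on_def)
  ultimately show ?thesis
    using a b D by (auto simp: pe qe partial_automorphisms_iff)
qed

lemma commensurator_relI:
  assumes "(H, f) \<in> partial_automorphisms G" "(H', f') \<in> partial_automorphisms G"
    and "finite_index_subgroup G L" "L \<subseteq> H" "L \<subseteq> H'" "\<And>x. x \<in> L \<Longrightarrow> f x = f' x"
  shows "((H, f), (H', f')) \<in> commensurator_rel G"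
  using assms unfolding commensurator_rel_def by blast

lemma equiv_commensurator_rel:
  "equiv (partial_automorphisms G) (commensurator_rel G)"
proof (rule equivI)
  show "commensurator_rel G \<subseteq> partial_automorphisms G \<times> partial_automorphisms G"
    by (auto simp: commensurator_rel_def)
  show "refl_on (partial_automorphisms G) (commensurator_rel G)"
    by (rule refl_onI) (auto simp: commensurator_rel_def partial_automorphisms_def)
  show "sym (commensurator_rel G)"
    by (rule symI) (force simp: commensurator_rel_def)
  show "trans (commensurator_rel G)"
  proof (rule transI)
    fix p q r assume pq: "(p, q) \<in> commensurator_rel G" and qr: "(q, r) \<in> commensurator_rel G"
    obtain H f H' f' H'' f'' where e: "p = (H, f)" "q = (H', f')" "r = (H'', f'')" 
      by (metis surj_pair)
    obtain L where L: "finite_index_subgroup G L" "L \<subseteq> H \<inter> H'" "\<forall>x\<in>L. f x = f' x"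
      using pq by (auto simp: e commensurator_rel_def)
    obtain M where M: "finite_index_subgroup G M" "M \<subseteq> H' \<inter> H''" "\<forall>x\<in>M. f' x = f'' x"
      using qr by (auto simp: e commensurator_rel_def)
    show "(p, r) \<in> commensurator_rel G" unfolding e
      by (rule commensurator_relI[OF _ _ finite_index_subgroup_Int[OF L(1) M(1)]])
        (use L M pq qr in \<open>auto simp: e commensurator_rel_def\<close>)
  qed
qed

lemma partial_comp_cong:
  assumes pp: "(p, p') \<in> commensurator_rel G" and qq: "(q, q') \<in> commensurator_rel G"
  shows "(partial_comp p q, partial_comp p' q') \<in> commensurator_rel G"
proof -
  obtain H f H' f' K g K' g' where e: "p = (H, f)" "p' = (H', f')" "q = (K, g)" "q' = (K', g')"
    by (metis surj_pair)
  have mem: "p \<in> partial_automorphisms G" "p' \<in> partial_automorphisms G"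
      "q \<in> partial_automorphisms G" "q' \<in> partial_automorphisms G"
    using pp qq by (auto simp: commensurator_rel_def)
  obtain L where L: "finite_index_subgroup G L" "L \<subseteq> H \<inter> H'" "\<forall>x\<in>L. f x = f' x"
    using pp by (auto simp: e commensurator_rel_def)
  obtain M where M: "finite_index_subgroup G M" "M \<subseteq> K \<inter> K'" "\<forall>x\<in>M. g x = g' x"
    using qq by (auto simp: e commensurator_rel_def)
  have "finite_index_subgroup G {x \<in> K. g x \<in> L}"
    using finite_index_subgroup_vimage[OF _ L(1) partial_automorphisms_hom] mem
    by (auto simp: e partial_automorphisms_iff)
  then have fi: "finite_index_subgroup G (M \<inter> {x \<in> K. g x \<in> L})"
    using finite_index_subgroup_Int M(1) by blast
  have "((fst (partial_comp p q), snd (partial_comp p q)),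
      (fst (partial_comp p' q'), snd (partial_comp p' q'))) \<in> commensurator_rel G"
    by (rule commensurator_relI[OF _ _ fi])
      (use L M mem partial_comp_closed in \<open>auto simp: e simp del: partial_comp.simps\<close>,
       use L M in \<open>auto simp: e\<close>)
  then show ?thesis by simp
qed

lemma partial_comp_assoc: "partial_comp (partial_comp p q) r = partial_comp p (partial_comp q r)"
  by (cases p; cases q; cases r) (auto simp: fun_eq_iff)

declare partial_comp.simps [simp del]

lemma mult_Comm:
  assumes "p \<in> partial_automorphisms G" "q \<in> partial_automorphisms G"
  shows "(commensurator_rel G `` {p}) \<otimes>\<^bsub>Comm G\<^esub> (commensurator_rel G `` {q})
       = commensurator_rel G `` {partial_comp p q}"
proof -
  have "congruent2 (commensurator_rel G) (commensurator_rel G)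
      (\<lambda>p q. commensurator_rel G `` {partial_comp p q})"
    unfolding congruent2_def
    using equiv_class_eq[OF equiv_commensurator_rel partial_comp_cong] by blast
  from UN_equiv_class2[OF equiv_commensurator_rel equiv_commensurator_rel this assms]
  show ?thesis by (simp add: Comm_def)
qed

lemma group_Comm: "group (Comm G)"
proof -
  let ?R = "commensurator_rel G" and ?P = "partial_automorphisms G"
  let ?id = "(carrier G, \<lambda>x\<in>carrier G. x)"
  have id: "?id \<in> ?P"
    by (auto simp: partial_automorphisms_iff finite_index_subgroup_carrier inj_on_def)
  have clsI: "?R `` {p} \<in> carrier (Comm G)" if "p \<in> ?P" for p
    using that by (auto simp: Comm_def quotientI)
  have clsE: "\<exists>p\<in>?P. U = ?R `` {p}" if "U \<in> carrier (Comm G)" for U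
    using that by (auto simp: Comm_def elim: quotientE)
  have one: "\<one>\<^bsub>Comm G\<^esub> = ?R `` {?id}" by (simp add: Comm_def)
  show ?thesis
  proof (rule groupI)
    fix U V W assume "U \<in> carrier (Comm G)" "V \<in> carrier (Comm G)" "W \<in> carrier (Comm G)"
    then show "U \<otimes>\<^bsub>Comm G\<^esub> V \<otimes>\<^bsub>Comm G\<^esub> W = U \<otimes>\<^bsub>Comm G\<^esub> (V \<otimes>\<^bsub>Comm G\<^esub> W)"
      by (auto dest!: clsE simp: mult_Comm partial_comp_closed partial_comp_assoc simp del: Image_singleton_iff)
  next
    fix U V assume "U \<in> carrier (Comm G)" "V \<in> carrier (Comm G)"
    then show "U \<otimes>\<^bsub>Comm G\<^esub> V \<in> carrier (Comm G)"
      by (auto dest!: clsE simp: mult_Comm partial_comp_closed clsI)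
  next
    show "\<one>\<^bsub>Comm G\<^esub> \<in> carrier (Comm G)" by (simp add: one clsI id)
  next
    fix U assume "U \<in> carrier (Comm G)"
    then obtain H f where p: "(H, f) \<in> ?P" and U: "U = ?R `` {(H, f)}" by (metis clsE surj_pair)
    note a = p[unfolded partial_automorphisms_iff]
    have sub: "f ` H \<subseteq> carrier G" "H \<subseteq> carrier G"
      using a finite_index_subgroupD(1) subgroup.subset by blast+
    have "partial_comp ?id (H, f) = (H, f)"
      using a sub extensional_arb[of f H]
      by (auto simp: fun_eq_iff partial_comp.simps image_subset_iff)
    then show "\<one>\<^bsub>Comm G\<^esub> \<otimes>\<^bsub>Comm G\<^esub> U = U" by (simp only: one U mult_Comm id p)
    let ?q = "(f ` H, \<lambda>x\<in>f ` H. inv_into H f x)"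
    have q: "?q \<in> ?P" using partial_automorphisms_inv p by blast
    have e: "partial_comp ?q (H, f) = (H, \<lambda>x\<in>H. x)"
      using a by (auto simp: fun_eq_iff partial_comp.simps)
    have "(H, \<lambda>x\<in>H. x) \<in> ?P" using partial_comp_closed[OF q p] e by simp
    then have "((H, \<lambda>x\<in>H. x), ?id) \<in> ?R"
      by (rule commensurator_relI[OF _ id, where L = H]) (use a sub in auto)
    then have "?R `` {?q} \<otimes>\<^bsub>Comm G\<^esub> U = \<one>\<^bsub>Comm G\<^esub>"
      by (simp only: one U mult_Comm q p e) (rule equiv_class_eq[OF equiv_commensurator_rel])
    then show "\<exists>V\<in>carrier (Comm G). V \<otimes>\<^bsub>Comm G\<^esub> U = \<one>\<^bsub>Comm G\<^esub>"
      using clsI[OF q] by blast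
  qed
qed

end

end

(*
  Let n be the order of F.  The finite-index subgroup of pairs (f, k) with n dividing k is
  isomorphic to the wreath product of (Z/2)^n with Z, so permutations of n letters act on it by
  permuting the lamps inside each block of n consecutive lamps.  Via the left regular action this
  gives an action of F by automorphisms.  It stays faithful on every finite-index subgroup L: by
  the pigeonhole principle L contains an element that lights exactly two lamps, both at multiples
  of n, and a non-trivial g moves these lamps to positions that are not multiples of n.
*)
theory Submission
  imports Defs
begin

text \<open>Each \<open>\<phi> g\<close> is an automorphism of \<open>H\<close>, hence a partial
  automorphism of \<open>G\<close>, and passing to classes is a homomorphism. Two classes coincide
  when the maps agree on some finite-index subgroup, so injectivity amounts to faithfulness on every
  finite-index \<open>L\<close> inside \<open>H\<close>, not just on \<open>H\<close>
  itself.\<close>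

lemma (in group) embeds_in_Comm:
  fixes F :: "('c, 'd) monoid_scheme"
  assumes F: "group F" and H: "finite_index_subgroup G H"
    and hom: "\<And>g. g \<in> carrier F \<Longrightarrow> \<phi> g \<in> hom (G\<lparr>carrier := H\<rparr>) (G\<lparr>carrier := H\<rparr>)"
    and one: "\<And>x. x \<in> H \<Longrightarrow> \<phi> \<one>\<^bsub>F\<^esub> x = x"
    and mult: "\<And>g h x. \<lbrakk>g \<in> carrier F; h \<in> carrier F; x \<in> H\<rbrakk> \<Longrightarrow> \<phi> (g \<otimes>\<^bsub>F\<^esub> h) x = \<phi> g (\<phi> h x)"
    and faithful: "\<And>g L. \<lbrakk>g \<in> carrier F; finite_index_subgroup G L; L \<subseteq> H; \<forall>x\<in>L. \<phi> g x = x\<rbrakk>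
                     \<Longrightarrow> g = \<one>\<^bsub>F\<^esub>"
  shows "\<exists>S. subgroup S (Comm G) \<and> F \<cong> (Comm G)\<lparr>carrier := S\<rparr>"
proof -
  interpret F: group F by fact
  interpret C: group "Comm G" by (rule group_Comm)
  \<comment> \<open>The restriction makes the map extensional, as the encoding of partial
    automorphisms demands.\<close>
  define p where "p g = (H, restrict (\<phi> g) H)" for g
  define \<Phi> where "\<Phi> g = commensurator_rel G `` {p g}" for g
  have cl: "\<phi> g x \<in> H" if "g \<in> carrier F" "x \<in> H" for g x
    using hom[OF that(1)] that(2) by (auto simp: hom_def)
  have inv_left: "\<phi> (inv\<^bsub>F\<^esub> g) (\<phi> g x) = x" if "g \<in> carrier F" "x \<in> H" for g x
    using mult[of "inv\<^bsub>F\<^esub> g" g x] that one by simp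
  have inv_right: "\<phi> g (\<phi> (inv\<^bsub>F\<^esub> g) x) = x" if "g \<in> carrier F" "x \<in> H" for g x
    using mult[of g "inv\<^bsub>F\<^esub> g" x] that one by simp
  have p: "p g \<in> partial_automorphisms G" if g: "g \<in> carrier F" for g
  proof -
    have "x \<in> \<phi> g ` H" if "x \<in> H" for x
      using inv_right[OF g that] cl[OF F.inv_closed[OF g] that] by (metis imageI)
    then have "restrict (\<phi> g) H ` H = H"
      using cl[OF g] by (simp only: image_restrict_eq) blast
    moreover have "inj_on (restrict (\<phi> g) H) H"
      by (rule inj_on_inverseI[where g = "\<phi> (inv\<^bsub>F\<^esub> g)"]) (simp add: inv_left g)
    moreover have "\<phi> g (x \<otimes> y) = \<phi> g x \<otimes> \<phi> g y" if "x \<in> H" "y \<in> H" for x y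
      using hom[OF g] that by (auto simp: hom_def)
    moreover have "x \<otimes> y \<in> H" if "x \<in> H" "y \<in> H" for x y
      using finite_index_subgroupD(1)[OF H] that subgroup.m_closed by metis
    ultimately show ?thesis
      using H unfolding p_def partial_automorphisms_iff by simp
  qed
  \<comment> \<open>\<open>\<phi> h\<close> maps \<open>H\<close> into itself, so the domain of the
    composite does not shrink and the equality holds for representatives, not only for
    classes.\<close>
  have comp: "partial_comp (p g) (p h) = p (g \<otimes>\<^bsub>F\<^esub> h)"
    if "g \<in> carrier F" "h \<in> carrier F" for g h
    using that by (auto simp: p_def partial_comp.simps cl mult fun_eq_iff)
  have "\<Phi> \<in> hom F (Comm G)"
  proof (rule homI)
    show "\<Phi> g \<in> carrier (Comm G)" if "g \<in> carrier F" for g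
      using p[OF that] by (auto simp: \<Phi>_def Comm_def quotientI)
    show "\<Phi> (g \<otimes>\<^bsub>F\<^esub> h) = \<Phi> g \<otimes>\<^bsub>Comm G\<^esub> \<Phi> h" if "g \<in> carrier F" "h \<in> carrier F" for g h
      unfolding \<Phi>_def using that by (simp only: mult_Comm p comp)
  qed
  then interpret \<Phi>: group_hom F "Comm G" \<Phi>
    by unfold_locales
  have "inj_on \<Phi> (carrier F)"
  proof (rule inj_onI)
    fix g h assume g: "g \<in> carrier F" and h: "h \<in> carrier F" and "\<Phi> g = \<Phi> h"
    then have "(p g, p h) \<in> commensurator_rel G"
      unfolding \<Phi>_def using eq_equiv_class[OF _ equiv_commensurator_rel p] by blast
    then obtain L where L: "finite_index_subgroup G L" "L \<subseteq> H"
      and "\<forall>x\<in>L. restrict (\<phi> g) H x = restrict (\<phi> h) H x"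
      by (auto simp: p_def commensurator_rel_def)
    then have "\<phi> g x = \<phi> h x" if "x \<in> L" for x
      using that by (metis restrict_apply' subsetD)
    \<comment> \<open>Agreement of two elements on \<open>L\<close> becomes triviality of a single
      one, the form in which \<open>faithful\<close> applies.\<close>
    then have "\<forall>x\<in>L. \<phi> (inv\<^bsub>F\<^esub> h \<otimes>\<^bsub>F\<^esub> g) x = x"
      using L(2) g h by (auto simp: mult inv_left)
    then have "inv\<^bsub>F\<^esub> h \<otimes>\<^bsub>F\<^esub> g = \<one>\<^bsub>F\<^esub>"
      using faithful[OF _ L] g h by simp
    then show "g = h"
      using g h by (metis F.inv_closed F.inv_equality F.inv_inv)
  qed
  then have "\<Phi> \<in> iso F ((Comm G)\<lparr>carrier := \<Phi> ` carrier F\<rparr>)"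
    using \<Phi>.homh by (auto simp: iso_def hom_def bij_betw_def)
  then show ?thesis
    using \<Phi>.img_is_subgroup is_isoI by blast
qed

text \<open>The left regular action of \<open>G\<close>, transported to each block \<open>{q n..<(q + 1) n}\<close> of integers.\<close>

lemma (in group) ex_block_action:
  assumes fin: "finite (carrier G)"
  obtains n :: int and \<sigma> :: "'a \<Rightarrow> int \<Rightarrow> int"
  where "n > 0"
    and "\<And>x. \<sigma> \<one> x = x"
    and "\<And>g h x. \<lbrakk>g \<in> carrier G; h \<in> carrier G\<rbrakk> \<Longrightarrow> \<sigma> (g \<otimes> h) x = \<sigma> g (\<sigma> h x)"
    and "\<And>g x k. n dvd k \<Longrightarrow> \<sigma> g (x + k) = \<sigma> g x + k"
    and "\<And>g x. \<lbrakk>g \<in> carrier G; n dvd \<sigma> g x - x\<rbrakk> \<Longrightarrow> g = \<one>"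
proof -
  define n where "n = int (card (carrier G))"
  have n: "n > 0" using fin one_closed by (auto simp: n_def card_gt_0_iff)
  have "card {0..<n} = card (carrier G)" by (simp add: n_def)
  then obtain d where d: "bij_betw d {0..<n} (carrier G)"
    using finite_same_card_bij[OF _ fin] by blast
  define c where "c = inv_into {0..<n} d"
  have c: "c g \<in> {0..<n}" "d (c g) = g" if "g \<in> carrier G" for g
    using bij_betw_inv_into[OF d] d that
    by (auto simp: c_def bij_betw_def f_inv_into_f)
  have cd: "c (d x) = x" if "x \<in> {0..<n}" for x
    using d that by (simp add: c_def bij_betw_def)
  have dm: "d (x mod n) \<in> carrier G" for x
    using d n by (auto intro: bij_betw_apply)
  \<comment> \<open>\<open>\<sigma> g\<close> keeps the block \<open>x div n\<close> and multiplies
    the group element numbered \<open>x mod n\<close> by \<open>g\<close> on the left.\<close>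
  define \<sigma> where "\<sigma> g x = n * (x div n) + c (g \<otimes> d (x mod n))" for g x
  have mod: "\<sigma> g x mod n = c (g \<otimes> d (x mod n))" and div: "\<sigma> g x div n = x div n"
    if "g \<in> carrier G" for g x
    using c(1)[of "g \<otimes> d (x mod n)"] that dm[of x] n by (simp_all add: \<sigma>_def)
  show thesis
  proof (rule that[OF n, of \<sigma>])
    show "\<sigma> \<one> x = x" for x
      using n dm[of x] by (simp add: \<sigma>_def cd)
    show "\<sigma> (g \<otimes> h) x = \<sigma> g (\<sigma> h x)" if "g \<in> carrier G" "h \<in> carrier G" for g h x
      \<comment> \<open>Only the outer applications are unfolded; \<open>mod\<close> and
        \<open>div\<close> then evaluate the inner \<open>\<sigma> h x\<close>.\<close>
      unfolding \<sigma>_def[of g] \<sigma>_def[of "g \<otimes> h"]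
      using that dm[of x] by (simp add: mod div c m_assoc)
    show "\<sigma> g (x + k) = \<sigma> g x + k" if "n dvd k" for g x k
      using that n by (auto simp: \<sigma>_def distrib_left)
    show "g = \<one>" if g: "g \<in> carrier G" and "n dvd \<sigma> g x - x" for g x
    proof -
      \<comment> \<open>Equal residues mean that left multiplication by \<open>g\<close> fixes a
        group element, which forces \<open>g\<close> to be trivial by cancellation.\<close>
      have "c (g \<otimes> d (x mod n)) = x mod n"
        using that mod[OF g] by (metis mod_eq_dvd_iff)
      then have "g \<otimes> d (x mod n) = d (x mod n)"
        using c(2)[of "g \<otimes> d (x mod n)"] g dm[of x] by simp
      then show ?thesis using g dm r_cancel_one by blast
    qed
  qed
qed

lemma carrier_lamplighter_group:
  "carrier lamplighter_group = {f. range f \<subseteq> {0..<2} \<and> finite {i. f i \<noteq> 0}} \<times> UNIV"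
  by (auto simp: lamplighter_group_def restricted_wreath_product_def semidirect_product_def
      carrier_sum_group carrier_integer_mod_group integer_group_def)

lemma mult_lamplighter_group:
  "(f, h) \<otimes>\<^bsub>lamplighter_group\<^esub> (f', k) = (\<lambda>x. (f x + f' (x - h)) mod 2, h + k)"
  by (auto simp: lamplighter_group_def restricted_wreath_product_def semidirect_product_def
      mult_integer_mod_group fun_eq_iff)

lemma one_lamplighter_group: "\<one>\<^bsub>lamplighter_group\<^esub> = (\<lambda>x. 0, 0)"
  by (auto simp: lamplighter_group_def restricted_wreath_product_def semidirect_product_def
      fun_eq_iff)

interpretation LL: group lamplighter_group
  by (rule group_lamplighter_group)

lemma snd_hom_lamplighter_group: "group_hom lamplighter_group integer_group snd"
  by (auto simp: group_hom_def group_hom_axioms_def group_lamplighter_group hom_def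
      mult_lamplighter_group)

lemma snd_inv_lamplighter_group:
  "x \<in> carrier lamplighter_group \<Longrightarrow> snd (inv\<^bsub>lamplighter_group\<^esub> x) = - snd x"
  using group_hom.hom_inv[OF snd_hom_lamplighter_group] by simp

text \<open>This is the preimage of the multiples of \<open>n\<close> under the projection to the
  integers, so the residue of \<open>snd x\<close> separates its cosets. It will be the domain of
  the action: its elements shift lamps by whole blocks.\<close>

lemma finite_index_subgroup_lamplighter_dvd:
  assumes "n > 0"
  shows "finite_index_subgroup lamplighter_group {x \<in> carrier lamplighter_group. n dvd snd x}"
    (is "finite_index_subgroup _ ?H")
proof (rule LL.finite_index_subgroupI[where c = "\<lambda>x. snd x mod n"])
  have snd_mult: "snd (x \<otimes>\<^bsub>lamplighter_group\<^esub> y) = snd x + snd y" for x y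
    by (cases x; cases y) (simp add: mult_lamplighter_group)
  show "subgroup ?H lamplighter_group"
  proof (rule LL.subgroupI)
    have "\<one>\<^bsub>lamplighter_group\<^esub> \<in> ?H" 
      using LL.one_closed by (simp add: one_lamplighter_group)
    then show "?H \<noteq> {}" by blast
  qed (auto simp: snd_mult snd_inv_lamplighter_group)
  have "(\<lambda>x. snd x mod n) ` carrier lamplighter_group \<subseteq> {0..<n}"
    using assms by auto
  then show "finite ((\<lambda>x. snd x mod n) ` carrier lamplighter_group)"
    by (rule finite_subset) simp
  show "x \<otimes>\<^bsub>lamplighter_group\<^esub> inv\<^bsub>lamplighter_group\<^esub> y \<in> ?H"
    if "x \<in> carrier lamplighter_group" "y \<in> carrier lamplighter_group" "snd x mod n = snd y mod n"
    for x y
    using that by (simp add: snd_mult snd_inv_lamplighter_group mod_eq_dvd_iff)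
qed

text \<open>The single-lamp elements \<open>\<delta> a\<close> with \<open>a\<close> in
  \<open>A\<close> lie in finitely many cosets of \<open>L\<close>, so two of them share one; their
  quotient is in \<open>L\<close>. The set \<open>A\<close> is left free in order to prescribe where
  the two lamps stand.\<close>

lemma finite_index_lamplighter_two_lamps:
  assumes L: "finite_index_subgroup lamplighter_group L" and A: "infinite A"
  obtains a b where "a \<in> A" "b \<in> A" "a \<noteq> b" "(\<lambda>x. if x = a \<or> x = b then 1 else 0, 0) \<in> L"
proof -
  define \<delta> :: "int \<Rightarrow> (int \<Rightarrow> int) \<times> int" where "\<delta> a = (\<lambda>x. if x = a then 1 else 0, 0)" for a
  have \<delta>: "\<delta> a \<in> carrier lamplighter_group" for a
    by (auto simp: \<delta>_def carrier_lamplighter_group)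
  have "(\<lambda>a. L #>\<^bsub>lamplighter_group\<^esub> \<delta> a) ` A
      \<subseteq> (\<lambda>x. L #>\<^bsub>lamplighter_group\<^esub> x) ` carrier lamplighter_group"
    using \<delta> by blast
  then have "finite ((\<lambda>a. L #>\<^bsub>lamplighter_group\<^esub> \<delta> a) ` A)"
    using LL.finite_index_subgroupD(2)[OF L] finite_subset by blast
  then have "\<not> inj_on (\<lambda>a. L #>\<^bsub>lamplighter_group\<^esub> \<delta> a) A"
    using A finite_imageD by blast
  then obtain a b where ab: "a \<in> A" "b \<in> A" "a \<noteq> b"
    and "L #>\<^bsub>lamplighter_group\<^esub> \<delta> a = L #>\<^bsub>lamplighter_group\<^esub> \<delta> b"
    by (auto simp: inj_on_def)
  then have "\<delta> a \<otimes>\<^bsub>lamplighter_group\<^esub> inv\<^bsub>lamplighter_group\<^esub> \<delta> b \<in> L"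
    using LL.finite_index_subgroupD(3)[OF L] \<delta> by blast
  moreover have "inv\<^bsub>lamplighter_group\<^esub> \<delta> b = \<delta> b"
    by (rule LL.inv_equality)
      (auto simp: \<delta>, auto simp: \<delta>_def mult_lamplighter_group one_lamplighter_group)
  \<comment> \<open>Since \<open>a\<close> and \<open>b\<close> differ, the two lamps do not cancel
    modulo 2.\<close>
  moreover have "\<delta> a \<otimes>\<^bsub>lamplighter_group\<^esub> \<delta> b = (\<lambda>x. if x = a \<or> x = b then 1 else 0, 0)"
    using ab(3) by (auto simp: \<delta>_def mult_lamplighter_group fun_eq_iff)
  ultimately show thesis using that ab by simp
qed

theorem mainTheorem5:
  fixes F :: "('a, 'b) monoid_scheme"
  assumes "group F" and "finite (carrier F)"
  shows "\<exists>S. subgroup S (Comm lamplighter_group) \<and> F \<cong> (Comm lamplighter_group)\<lparr>carrier := S\<rparr>"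
proof -
  interpret F: group F by fact
  obtain n :: int and \<sigma> where n: "n > 0"
    and \<sigma>_one: "\<And>x. \<sigma> \<one>\<^bsub>F\<^esub> x = x"
    and \<sigma>_mult: "\<And>g h x. \<lbrakk>g \<in> carrier F; h \<in> carrier F\<rbrakk> \<Longrightarrow> \<sigma> (g \<otimes>\<^bsub>F\<^esub> h) x = \<sigma> g (\<sigma> h x)"
    and \<sigma>_add: "\<And>g x k. n dvd k \<Longrightarrow> \<sigma> g (x + k) = \<sigma> g x + k"
    and \<sigma>_free: "\<And>g x. \<lbrakk>g \<in> carrier F; n dvd \<sigma> g x - x\<rbrakk> \<Longrightarrow> g = \<one>\<^bsub>F\<^esub>"
    using F.ex_block_action[OF assms(2)] by blast
  let ?H = "{x \<in> carrier lamplighter_group. n dvd snd x}"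
  \<comment> \<open>The lamp at \<open>i\<close> moves to \<open>\<sigma> g i\<close> and the
    integer coordinate stays. Precomposition reverses the order of products; the inverse restores
    it, giving a left action.\<close>
  define \<phi> :: "'a \<Rightarrow> (int \<Rightarrow> int) \<times> int \<Rightarrow> (int \<Rightarrow> int) \<times> int"
    where "\<phi> g x = (\<lambda>i. fst x (\<sigma> (inv\<^bsub>F\<^esub> g) i), snd x)" for g x
  have \<sigma>_inv: "\<sigma> (inv\<^bsub>F\<^esub> g) (\<sigma> g i) = i" if "g \<in> carrier F" for g i
    using \<sigma>_mult[of "inv\<^bsub>F\<^esub> g" g i] that \<sigma>_one by simp
  have \<sigma>_diff: "\<sigma> g (i - k) = \<sigma> g i - k" if "n dvd k" for g i k
    using \<sigma>_add[of "- k" g i] that by simp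
  have \<phi>_carrier: "\<phi> g x \<in> carrier lamplighter_group"
    if g: "g \<in> carrier F" and x: "x \<in> carrier lamplighter_group" for g x
  proof -
    \<comment> \<open>Injectivity keeps the support finite after precomposition.\<close>
    have "inj (\<sigma> (inv\<^bsub>F\<^esub> g))"
      using \<sigma>_inv[of "inv\<^bsub>F\<^esub> g"] g by (metis F.inv_closed injI)
    moreover have "finite {i. fst x i \<noteq> 0}"
      using x by (auto simp: carrier_lamplighter_group)
    ultimately have "finite (\<sigma> (inv\<^bsub>F\<^esub> g) -` {i. fst x i \<noteq> 0})"
      by (rule finite_vimageI[rotated])
    then show ?thesis
      using x by (auto simp: \<phi>_def carrier_lamplighter_group)
  qed
  show ?thesis
  proof (rule LL.embeds_in_Comm[OF assms(1) finite_index_subgroup_lamplighter_dvd[OF n], of \<phi>])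
    fix g assume g: "g \<in> carrier F"
    show "\<phi> g \<in> hom (lamplighter_group\<lparr>carrier := ?H\<rparr>) (lamplighter_group\<lparr>carrier := ?H\<rparr>)"
    proof (rule homI)
      show "\<phi> g x \<in> carrier (lamplighter_group\<lparr>carrier := ?H\<rparr>)"
        if "x \<in> carrier (lamplighter_group\<lparr>carrier := ?H\<rparr>)" for x
        using that \<phi>_carrier[OF g] by (simp add: \<phi>_def)
      \<comment> \<open>Multiplication shifts the second configuration by \<open>snd x\<close>; in
        \<open>?H\<close> this is a multiple of \<open>n\<close>, so the shift commutes with
        \<open>\<sigma>\<close> by \<open>\<sigma>_diff\<close>.\<close>
      show "\<phi> g (x \<otimes>\<^bsub>lamplighter_group\<lparr>carrier := ?H\<rparr>\<^esub> y)
          = \<phi> g x \<otimes>\<^bsub>lamplighter_group\<lparr>carrier := ?H\<rparr>\<^esub> \<phi> g y"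
        if "x \<in> carrier (lamplighter_group\<lparr>carrier := ?H\<rparr>)" for x y
        using that by (cases x; cases y) (simp add: \<phi>_def mult_lamplighter_group \<sigma>_diff)
    qed
  next
    show "\<phi> \<one>\<^bsub>F\<^esub> x = x" for x by (simp add: \<phi>_def \<sigma>_one)
  next
    show "\<phi> (g \<otimes>\<^bsub>F\<^esub> h) x = \<phi> g (\<phi> h x)" if "g \<in> carrier F" "h \<in> carrier F" for g h x
      using that by (simp add: \<phi>_def F.inv_mult_group \<sigma>_mult)
  next
    fix g L assume g: "g \<in> carrier F" and L: "finite_index_subgroup lamplighter_group L"
      and fix_L: "\<forall>x\<in>L. \<phi> g x = x"
    \<comment> \<open>Both lamps are placed at multiples of \<open>n\<close>, hence in one residue
      class, which is what \<open>\<sigma>_free\<close> can detect.\<close>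
    have "infinite (range ((*) n))"
      using n by (subst finite_image_iff) (auto simp: inj_on_def)
    from finite_index_lamplighter_two_lamps[OF L this]
    obtain a b where "a \<in> range ((*) n)" "b \<in> range ((*) n)"
      and "(\<lambda>x. if x = a \<or> x = b then 1 else 0, 0) \<in> L" .
    then obtain q r where "(\<lambda>x. if x = n * q \<or> x = n * r then 1 else 0, 0) \<in> L"
      by auto
    then have "\<phi> g (\<lambda>x. if x = n * q \<or> x = n * r then 1 else 0, 0)
        = (\<lambda>x. if x = n * q \<or> x = n * r then 1 else 0, 0)"
      using fix_L by blast
    then have "(if \<sigma> (inv\<^bsub>F\<^esub> g) i = n * q \<or> \<sigma> (inv\<^bsub>F\<^esub> g) i = n * r then 1 else 0)
        = (if i = n * q \<or> i = n * r then 1 else (0 :: int))" for i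
      by (simp only: \<phi>_def prod.inject fst_conv fun_eq_iff)
    \<comment> \<open>At the new position of the lamp \<open>n * q\<close> the moved configuration
      is lit, so the original is lit there too. That position is thus one of the two multiples of
      \<open>n\<close>.\<close>
    from this[of "\<sigma> g (n * q)"] have "\<sigma> g (n * q) = n * q \<or> \<sigma> g (n * q) = n * r"
      by (simp add: \<sigma>_inv g split: if_splits)
    then have "n dvd \<sigma> g (n * q) - n * q" by auto
    then show "g = \<one>\<^bsub>F\<^esub>" by (rule \<sigma>_free[OF g])
  qed
qed

end
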